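(* Let $r$ be a fixed positive integer. For $n\ge 2r$ and $P$ a set of $n$ points on the moment curve $\gamma_{2r}$ in $\mathbb{R}^{2r}$, we have $$\frac{b_{2r}(P)}{\tau_{2r}(P)}=\Omega_r(\log n).$$ That is, there exist a constant $c_r>0$ and an integer $N_r$, depending only on $r$, such that $b_{2r}(P)\ge c_r\,\tau_{2r}(P)\log n$ for every $n\ge N_r$ and every set $P$ of $n$ points on $\gamma_{2r}$.
   Context: The moment curve in $\mathbb{R}^d$ is the image of $\gamma_d(t)=(t,t^2,\dots,t^d)$, $t\in\mathbb{R}$. A finite set $P\subset\mathbb{R}^d$ is in general position if every subset of at most $d+1$ points is affinely independent (sets of distinct points on the moment curve satisfy this). For $P\subset\mathbb{R}^d$ in general position, $b_d(P)$ is the minimum of $|Q|$ over all sets $Q\subset\mathbb{R}^d\setminus P$ such that $Q\cap\operatorname{relint}\operatorname{conv}(A)\ne\emptyset$ for every $d$-element subset $A\subseteq P$. For a triangulation $T$ of $\operatorname{conv}(P)$ with vertex set equal to $P$ (a geometric simplicial complex with vertex set $P$ whose union is $\operatorname{conv}(P)$), $f_{d-1}(T)$ denotes the number of $(d-1)$-dimensional faces of $T$, and $\tau_d(P)=\max_T f_{d-1}(T)$, the maximum over all such triangulations $T$. Logarithms are natural. *)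

theory Defs
  imports "HOL-Analysis.Analysis"
begin

text \<open>Coordinates are indexed by a finite linearly ordered type, and
  \<^term>\<open>card {..i}\<close> is the rank of the coordinate \<open>i\<close>, counted from 1.\<close>

definition moment_curve :: "real \<Rightarrow> real ^ 'n::{finite,linorder}"
  where "moment_curve t = (\<chi> i. t ^ card {..i})"

lemma bij_betw_card_atMost:
  "bij_betw (\<lambda>i::'n::{finite,linorder}. card {..i}) UNIV {1..CARD('n)}"
proof -
  let ?f = "\<lambda>i::'n. card {..i}"
  have "strict_mono ?f"
    by (rule strict_monoI, rule psubset_card_mono) auto
  then have inj: "inj ?f"
    by (rule strict_mono_imp_inj_on)
  have "?f ` UNIV \<subseteq> {1..CARD('n)}"
    by (auto simp: Suc_le_eq card_gt_0_iff intro!: card_mono)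
  moreover have "card (?f ` UNIV) = card {1..CARD('n)}"
    using inj by (simp add: card_image)
  ultimately have "?f ` UNIV = {1..CARD('n)}"
    by (intro card_subset_eq) auto
  with inj show ?thesis
    by (simp add: bij_betw_def)
qed

definition blocks :: "'a::euclidean_space set \<Rightarrow> 'a set \<Rightarrow> bool"
  where "blocks Q P \<longleftrightarrow> Q \<inter> P = {} \<and>
    (\<forall>A \<subseteq> P. card A = DIM('a) \<longrightarrow> Q \<inter> rel_interior (convex hull A) \<noteq> {})"

text \<open>For finite \<open>P\<close> in dimension at least 2 a finite blocking set exists, so
  the infimum is a minimum, and restricting it to finite \<open>Q\<close> loses nothing.\<close>

definition blocking_number :: "'a::euclidean_space set \<Rightarrow> nat"
  where "blocking_number P = Inf (card ` {Q. finite Q \<and> blocks Q P})"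

lemma finite_blocking_set_exists:
  fixes P :: "'a::euclidean_space set"
  assumes "finite P" "DIM('a) \<ge> 2"
  shows "\<exists>Q. finite Q \<and> blocks Q P"
proof -
  define \<A> where "\<A> = {A. A \<subseteq> P \<and> card A = DIM('a)}"
  have "\<exists>x. x \<in> rel_interior (convex hull A) - P" if "A \<in> \<A>" for A
  proof -
    let ?R = "rel_interior (convex hull A)"
    have A: "card A \<ge> 2" "finite A"
      using that assms by (auto simp: \<A>_def finite_subset)
    have ne: "?R \<noteq> {}"
    proof -
      have "A \<noteq> {}"
        using A(1) by force
      then show ?thesis
        by (simp add: rel_interior_eq_empty)
    qed
    have "infinite ?R"
    proof
      assume "finite ?R"
      moreover have "connected ?R"
        by (simp add: convex_connected convex_rel_interior)
      ultimately obtain x where "?R = {x}"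
        using ne connected_finite_iff_sing[of ?R] by auto
      then have "closure (convex hull A) = {x}"
        using convex_closure_rel_interior[of "convex hull A"] by simp
      then have "A \<subseteq> {x}"
        using closure_subset[of "convex hull A"] hull_subset[of A convex] by simp
      then have "card A \<le> card {x}"
        by (intro card_mono) auto
      with A show False by simp
    qed
    then have "infinite (?R - P)"
      using assms by simp
    then have "?R - P \<noteq> {}"
      by (metis finite.emptyI)
    then show ?thesis
      by auto
  qed
  then obtain f where f: "\<And>A. A \<in> \<A> \<Longrightarrow> f A \<in> rel_interior (convex hull A) - P"
    using bchoice[of \<A> "\<lambda>A x. x \<in> rel_interior (convex hull A) - P"] by blast
  have "finite \<A>"
    using assms by (simp add: \<A>_def)
  moreover have "blocks (f ` \<A>) P"
    unfolding blocks_def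
  proof (intro conjI allI impI)
    show "f ` \<A> \<inter> P = {}"
      using f by auto
    fix A assume "A \<subseteq> P" "card A = DIM('a)"
    then have "A \<in> \<A>"
      by (simp add: \<A>_def)
    then show "f ` \<A> \<inter> rel_interior (convex hull A) \<noteq> {}"
      using f[of A] by auto
  qed
  ultimately show ?thesis
    by blast
qed

definition triangulation_of :: "'a::euclidean_space set set \<Rightarrow> 'a set \<Rightarrow> bool"
  where "triangulation_of \<T> P \<longleftrightarrow>
    simplicial_complex \<T> \<and> {v. {v} \<in> \<T>} = P \<and> \<Union>\<T> = convex hull P"

definition num_faces :: "int \<Rightarrow> 'a::euclidean_space set set \<Rightarrow> nat"
  where "num_faces k \<T> = card {S \<in> \<T>. k simplex S}"

text \<open>The set of face numbers is finite for finite \<open>P\<close>, so the supremum is a maximum.\<close>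

definition max_triangulation_facets :: "'a::euclidean_space set \<Rightarrow> nat"
  where "max_triangulation_facets P =
    Sup (num_faces (int DIM('a) - 1) ` {\<T>. triangulation_of \<T> P})"

lemma triangulation_of_subset:
  assumes "triangulation_of \<T> P"
  shows "\<T> \<subseteq> (hull) convex ` Pow P"
proof
  fix S assume S: "S \<in> \<T>"
  then obtain n where "n simplex S"
    using assms by (auto simp: triangulation_of_def simplicial_complex_def)
  then obtain C where C: "\<not> affine_dependent C" "S = convex hull C"
    by (auto simp: simplex_def)
  have "C \<subseteq> P"
  proof
    fix v assume "v \<in> C"
    then have "v extreme_point_of S"
      using C by (simp add: extreme_point_of_convex_hull_affine_independent)
    then have "{v} face_of S"
      by (simp add: face_of_singleton)
    then have "{v} \<in> \<T>"
      using assms S by (auto simp: triangulation_of_def simplicial_complex_def)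
    then show "v \<in> P"
      using assms by (auto simp: triangulation_of_def)
  qed
  with C show "S \<in> (hull) convex ` Pow P"
    by blast
qed

lemma finite_num_faces_triangulations:
  assumes "finite P"
  shows "finite (num_faces k ` {\<T>. triangulation_of \<T> P})"
proof -
  have "{\<T>. triangulation_of \<T> P} \<subseteq> Pow ((hull) convex ` Pow P)"
    using triangulation_of_subset by blast
  moreover have "finite (Pow ((hull) convex ` Pow P))"
    using assms by simp
  ultimately show ?thesis
    by (meson finite_imageI finite_subset)
qed

end

theory Submission
  imports Defs
begin

text \<open>
  Affine functionals on the moment curve in dimension \<open>2r\<close> are the polynomials of degree at
  most \<open>2r\<close>, so a hyperplane meets the curve at most \<open>2r\<close> times, and the hulls of two alternating
  sets of \<open>r + 1\<close> points intersect.

  In a triangulation every \<open>(2r - 1)\<close>-face lies in a \<open>2r\<close>-simplex, and a \<open>2r\<close>-simplex with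
  parameters \<open>a\<^sub>0 < \<dots> < a\<^sub>2\<^sub>r\<close> is determined by the tuple of its entries of even index, as two
  simplices with the same tuple would contain alternating faces. These \<open>(r + 1)\<close>-tuples are pairwise
  non-intertwining, and a deletion argument bounds their number by \<open>(r + 1) n\<^sup>r\<close>.

  For the lower bound, consider the \<open>2r\<close>-sets consisting of \<open>r - 1\<close> pairs of neighbouring points from
  the first half of \<open>P\<close> and one chord of length \<open>k\<close>, with weight \<open>1/k\<close>, in the second half. If a
  point lies in the relative interiors of the hulls of two such sets, then their chords cross. The
  length of a chord in a pairwise crossing family is at least the size of the family, so each
  blocking point accounts for total weight at most 1, while the weight of all these sets is of order
  \<open>n\<^sup>r log n\<close>.
\<close>

section \<open>The moment curve and polynomials\<close>

lemma inner_moment_curve: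
  fixes a :: "real ^ 'n::{finite,linorder}"
  shows "a \<bullet> moment_curve t = poly (\<Sum>i\<in>UNIV. monom (a $ i) (card {..i})) t"
  by (simp add: inner_vec_def moment_curve_def poly_sum poly_monom)

lemma degree_functional_poly:
  fixes a :: "real ^ 'n::{finite,linorder}"
  shows "degree ((\<Sum>i\<in>UNIV. monom (a $ i) (card {..i})) - [:b:]) \<le> CARD('n)"
proof -
  have "card {..i} \<le> CARD('n)" for i :: 'n
    by (rule card_mono) auto
  then show ?thesis
    by (intro degree_diff_le degree_sum_le) (auto intro: order.trans[OF degree_monom_le])
qed

text \<open>The exponents \<open>card {..i}\<close> are positive and pairwise distinct, so neither
  \<open>b\<close> nor another coordinate can cancel a nonzero coordinate of
  \<open>a\<close>.\<close>

lemma functional_poly_nonzero: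
  fixes a :: "real ^ 'n::{finite,linorder}"
  assumes "a \<noteq> 0"
  shows "(\<Sum>i\<in>UNIV. monom (a $ i) (card {..i})) - [:b:] \<noteq> 0"
proof -
  obtain i where i: "a $ i \<noteq> 0"
    using assms by (auto simp: vec_eq_iff)
  have inj: "card {..j} = card {..i} \<longleftrightarrow> j = i" for j :: 'n
    using bij_betw_card_atMost[where 'n = 'n] by (auto simp: bij_betw_def inj_on_def)
  have "card {..i} \<noteq> 0"
    by auto
  then have "coeff ((\<Sum>i\<in>UNIV. monom (a $ i) (card {..i})) - [:b:]) (card {..i}) = a $ i"
    by (simp add: coeff_sum inj coeff_pCons split: nat.split)
  with i show ?thesis
    by (metis coeff_0)
qed

text \<open>Converse translation, used to turn a polynomial with prescribed signs into a hyperplane.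
  The curve has no constant coordinate, so \<open>coeff p 0\<close> becomes the offset.\<close>

lemma poly_eq_functional:
  fixes p :: "real poly"
  assumes "degree p \<le> CARD('n::{finite,linorder})"
  obtains a :: "real ^ 'n::{finite,linorder}" where "\<And>t. poly p t = a \<bullet> moment_curve t + coeff p 0"
proof
  fix t :: real
  let ?a = "\<chi> i::'n. coeff p (card {..i})"
  have "poly p t = (\<Sum>k\<le>CARD('n). coeff p k * t ^ k)"
    unfolding poly_altdef using assms
    by (intro sum.mono_neutral_left) (auto simp: coeff_eq_0)
  also have "\<dots> = (\<Sum>k=1..CARD('n). coeff p k * t ^ k) + coeff p 0"
    by (simp add: atMost_atLeast0 sum.atLeast_Suc_atMost[of 0])
  also have "(\<Sum>k=1..CARD('n). coeff p k * t ^ k) = ?a \<bullet> moment_curve t"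
    using sum.reindex_bij_betw[OF bij_betw_card_atMost[where 'n = 'n], of "\<lambda>k. coeff p k * t ^ k"]
    by (simp add: inner_vec_def moment_curve_def)
  finally show "poly p t = ?a \<bullet> moment_curve t + coeff p 0" .
qed

lemma inj_moment_curve: "inj (moment_curve :: real \<Rightarrow> real ^ 'n::{finite,linorder})"
proof (rule injI)
  fix s t :: real
  assume eq: "moment_curve s = (moment_curve t :: real ^ 'n::{finite,linorder})"
  have "degree [:0, 1::real:] \<le> CARD('n)"
    by (simp add: Suc_le_eq)
  then obtain a :: "real ^ 'n::{finite,linorder}" where "\<And>t. poly [:0, 1:] t = a \<bullet> moment_curve t + coeff [:0, 1:] 0"
    using poly_eq_functional by blast
  from this[of s] this[of t] eq show "s = t"
    by simp
qed

lemma card_moment_curve_image: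
  "card (moment_curve ` A :: (real ^ 'n::{finite,linorder}) set) = card A"
  by (rule card_image) (rule inj_on_subset[OF inj_moment_curve subset_UNIV])

text \<open>A hull with empty interior lies in a hyperplane, whose nonzero polynomial would have
  more roots than its degree permits.\<close>

lemma interior_convex_hull_moment_curve:
  fixes X :: "real set"
  assumes "finite X" "card X > CARD('n::{finite,linorder})"
  shows "interior (convex hull (moment_curve ` X :: (real ^ 'n::{finite,linorder}) set)) \<noteq> {}"
proof
  assume "interior (convex hull (moment_curve ` X :: (real ^ 'n::{finite,linorder}) set)) = {}"
  then obtain a :: "real ^ 'n::{finite,linorder}" and b where a: "a \<noteq> 0"
    and ab: "convex hull (moment_curve ` X) \<subseteq> {x. a \<bullet> x = b}"
    using empty_interior_subset_hyperplane[OF convex_convex_hull] by metis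
  let ?p = "(\<Sum>i\<in>UNIV. monom (a $ i) (card {..i})) - [:b:]"
  have nz: "?p \<noteq> 0"
    using a by (rule functional_poly_nonzero)
  have "X \<subseteq> {x. poly ?p x = 0}"
  proof
    fix t assume "t \<in> X"
    then have "moment_curve t \<in> convex hull (moment_curve ` X :: (real ^ 'n::{finite,linorder}) set)"
      by (auto intro: hull_inc)
    with ab show "t \<in> {x. poly ?p x = 0}"
      by (auto simp: inner_moment_curve)
  qed
  then have "card X \<le> card {x. poly ?p x = 0}"
    using nz by (intro card_mono poly_roots_finite)
  also have "\<dots> \<le> degree ?p"
    using nz by (rule card_poly_roots_bound)
  also have "\<dots> \<le> CARD('n)"
    by (rule degree_functional_poly)
  finally show False
    using assms by simp
qed

text \<open>The hyperplane \<open>p = 0\<close> contains the hull of \<open>A\<close>, hence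
  \<open>q\<close>, and supports the hull of \<open>B\<close>. The face it cuts from the latter
  contains the relative interior point \<open>q\<close>, so it is the whole hull.\<close>

lemma poly_vanishes_on_hull_meeting_rel_interior:
  fixes p :: "real poly" and q :: "real ^ 'n::{finite,linorder}"
  assumes deg: "degree p \<le> CARD('n)"
    and A: "\<And>t. t \<in> A \<Longrightarrow> poly p t = 0" and B: "\<And>t. t \<in> B \<Longrightarrow> poly p t \<le> 0"
    and q: "q \<in> convex hull (moment_curve ` A)" "q \<in> rel_interior (convex hull (moment_curve ` B))"
    and "t \<in> B"
  shows "poly p t = 0"
proof -
  obtain a :: "real ^ 'n::{finite,linorder}" where a: "\<And>t. poly p t = a \<bullet> moment_curve t + coeff p 0"
    using poly_eq_functional[OF deg] by blast
  let ?b = "- coeff p 0"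
  let ?H = "{x. a \<bullet> x = ?b}" and ?B = "convex hull (moment_curve ` B) :: (real ^ 'n::{finite,linorder}) set"
  have "convex hull (moment_curve ` A) \<subseteq> ?H"
  proof (rule hull_minimal)
    show "moment_curve ` A \<subseteq> ?H"
      using A by (auto simp: a eq_neg_iff_add_eq_0)
  qed (rule convex_hyperplane)
  with q have "q \<in> ?H"
    by blast
  have "?B \<subseteq> {x. a \<bullet> x \<le> ?b}"
  proof (rule hull_minimal)
    show "moment_curve ` B \<subseteq> {x. a \<bullet> x \<le> ?b}"
      using B by (auto simp: a add.commute le_minus_iff minus_le_iff dest!: B[unfolded a])
  qed (rule convex_halfspace_le)
  then have "(?B \<inter> ?H) face_of ?B"
    by (intro face_of_Int_supporting_hyperplane_le) auto
  moreover have "(?B \<inter> ?H) \<inter> rel_interior ?B \<noteq> {}"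
    using q \<open>q \<in> ?H\<close> rel_interior_subset by blast
  ultimately have "?B \<subseteq> ?B \<inter> ?H"
    by (rule subset_of_face_of[OF _ subset_refl])
  moreover have "moment_curve t \<in> ?B"
    using \<open>t \<in> B\<close> by (auto intro: hull_inc)
  ultimately show ?thesis
    by (auto simp: a)
qed

section \<open>Alternating point sets on the curve\<close>

text \<open>The intermediate value theorem puts a root into each of the \<open>m\<close> gaps, and
  roots from different gaps are distinct.\<close>

lemma alternating_poly_degree:
  fixes p :: "real poly" and w :: "nat \<Rightarrow> real"
  assumes mono: "strict_mono_on {..m} w"
    and even: "\<And>k. k \<le> m \<Longrightarrow> even k \<Longrightarrow> poly p (w k) < 0"
    and odd: "\<And>k. k \<le> m \<Longrightarrow> odd k \<Longrightarrow> poly p (w k) > 0"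
  shows "m \<le> degree p"
proof -
  have "\<exists>x. w k < x \<and> x < w (Suc k) \<and> poly p x = 0" if "k < m" for k
  proof (rule poly_IVT[simplified Bex_def, simplified])
    show "w k < w (Suc k)"
      using mono that by (auto simp: strict_mono_on_def)
    show "poly p (w k) * poly p (w (Suc k)) < 0"
      using even[of k] odd[of k] even[of "Suc k"] odd[of "Suc k"] that
      by (cases "even k") (auto simp: mult_less_0_iff)
  qed
  then obtain z where z: "\<And>k. k < m \<Longrightarrow> w k < z k \<and> z k < w (Suc k) \<and> poly p (z k) = 0"
    by metis
  have less: "z i < z j" if "i < j" "j < m" for i j
  proof -
    have "w (Suc i) \<le> w j"
      using mono that by (metis Suc_leI atMost_iff less_imp_le order.trans strict_mono_on_leD)
    then show ?thesis
      using z[of i] z[of j] that by linarith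
  qed
  have "inj_on z {..<m}"
    by (rule linorder_inj_onI) (use less in force)+
  have nz: "p \<noteq> 0"
    using even[of 0] by auto
  have "m = card (z ` {..<m})"
    using \<open>inj_on z {..<m}\<close> by (simp add: card_image)
  also have "\<dots> \<le> card {x. poly p x = 0}"
    using nz z by (intro card_mono poly_roots_finite) auto
  also have "\<dots> \<le> degree p"
    using nz by (rule card_poly_roots_bound)
  finally show ?thesis .
qed

text \<open>A hyperplane strictly separating the two hulls would give a polynomial of degree at most
  \<open>CARD('n)\<close> with \<open>CARD('n) + 1\<close> sign changes.\<close>

lemma alternating_hulls_meet:
  fixes w :: "nat \<Rightarrow> real"
  assumes mono: "strict_mono_on {..Suc CARD('n::{finite,linorder})} w"
  shows "convex hull (moment_curve ` w ` {k. k \<le> Suc CARD('n) \<and> even k}) \<inter>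
    convex hull (moment_curve ` w ` {k. k \<le> Suc CARD('n) \<and> odd k}) \<noteq> ({} :: (real ^ 'n::{finite,linorder}) set)"
    (is "convex hull (?c ` w ` ?E) \<inter> convex hull (?c ` w ` ?O) \<noteq> {}")
proof
  have fin: "finite ?E" "finite ?O"
    by auto
  have ne: "?O \<noteq> {}"
    by (auto intro!: exI[of _ 1])
  assume "convex hull (?c ` w ` ?E) \<inter> convex hull (?c ` w ` ?O) = {}"
  then have "\<exists>a b. (\<forall>x\<in>convex hull (?c ` w ` ?E). a \<bullet> x < b) \<and>
      (\<forall>x\<in>convex hull (?c ` w ` ?O). a \<bullet> x > b)"
    using fin ne
    by (intro separating_hyperplane_closed_compact)
      (auto intro!: compact_imp_closed finite_imp_compact_convex_hull)
  then obtain a b where ab: "\<And>x. x \<in> convex hull (?c ` w ` ?E) \<Longrightarrow> a \<bullet> x < b"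
      "\<And>x. x \<in> convex hull (?c ` w ` ?O) \<Longrightarrow> a \<bullet> x > b"
    by blast
  let ?p = "(\<Sum>i\<in>UNIV. monom (a $ i) (card {..i})) - [:b:]"
  have "Suc CARD('n) \<le> degree ?p"
  proof (rule alternating_poly_degree[OF mono])
    fix k assume "k \<le> Suc CARD('n)" "even k"
    then have "?c (w k) \<in> convex hull (?c ` w ` ?E)"
      by (intro hull_inc) auto
    then show "poly ?p (w k) < 0"
      using ab(1)[of "?c (w k)"] by (simp add: inner_moment_curve)
  next
    fix k assume "k \<le> Suc CARD('n)" "odd k"
    then have "?c (w k) \<in> convex hull (?c ` w ` ?O)"
      by (intro hull_inc) auto
    then show "poly ?p (w k) > 0"
      using ab(2)[of "?c (w k)"] by (simp add: inner_moment_curve)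
  qed
  also have "\<dots> \<le> CARD('n)"
    by (rule degree_functional_poly)
  finally show False
    by simp
qed

section \<open>Non-intertwining tuples\<close>

text \<open>A tuple that is not counted on the right cannot be moved along \<open>R\<close> in entry
  \<open>i\<close> within \<open>F\<close>. Since \<open>R\<close> compares distinct entries, at
  most one such tuple exists for each choice of the other \<open>r\<close> entries. Leaving
  \<open>R\<close> open serves both maximal and minimal entries.\<close>

lemma card_le_peel:
  fixes F :: "(nat \<Rightarrow> 'a) set"
  assumes F: "F \<subseteq> {..r} \<rightarrow>\<^sub>E X" and X: "finite X" and i: "i \<le> r"
    and tot: "\<And>f g. f \<in> F \<Longrightarrow> g \<in> F \<Longrightarrow> f i \<noteq> g i \<Longrightarrow> R (f i) (g i) \<or> R (g i) (f i)"
  shows "card F \<le> card {f \<in> F. \<exists>v. R (f i) v \<and> f(i := v) \<in> F} + card X ^ r"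
proof -
  let ?U = "{f \<in> F. \<exists>v. R (f i) v \<and> f(i := v) \<in> F}"
  \<comment> \<open>Overwriting with \<open>undefined\<close> forgets entry \<open>i\<close> and
    keeps the function extensional on the remaining indices.\<close>
  let ?h = "\<lambda>f::nat \<Rightarrow> 'a. f(i := undefined)"
  have finF: "finite F"
    using F by (rule finite_subset) (auto intro: finite_PiE X)
  have "inj_on ?h (F - ?U)"
  proof (rule inj_onI)
    fix f g assume fg: "f \<in> F - ?U" "g \<in> F - ?U" "?h f = ?h g"
    have upd: "f = g(i := f i)" "g = f(i := g i)"
      using fg(3) by (metis fun_upd_triv fun_upd_upd)+
    have "f i = g i"
    proof (rule ccontr)
      assume "f i \<noteq> g i"
      then have "R (f i) (g i) \<or> R (g i) (f i)"
        using tot fg by auto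
      with fg upd show False
        by (metis (mono_tags, lifting) DiffE mem_Collect_eq)
    qed
    with upd(2) show "f = g"
      by (metis fun_upd_triv)
  qed
  moreover have "?h ` (F - ?U) \<subseteq> ({..r} - {i}) \<rightarrow>\<^sub>E X"
  proof
    fix g assume "g \<in> ?h ` (F - ?U)"
    then obtain f where "f \<in> F" "g = ?h f"
      by blast
    then show "g \<in> ({..r} - {i}) \<rightarrow>\<^sub>E X"
      using F by (auto simp: PiE_iff extensional_def subset_iff)
  qed
  ultimately have "card (F - ?U) \<le> card (({..r} - {i}) \<rightarrow>\<^sub>E X)"
    using X by (intro card_inj_on_le[of ?h]) (auto intro!: finite_PiE)
  also have "\<dots> = card X ^ r"
    using i by (simp add: card_PiE)
  finally have "card (F - ?U) \<le> card X ^ r" .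
  moreover have "card F = card ?U + card (F - ?U)"
    using finF by (subst card_Un_disjoint[symmetric]) (auto intro: arg_cong[of _ _ card])
  ultimately show ?thesis
    by simp
qed

text \<open>Repeatedly delete the tuples with a maximal entry \<open>r\<close>, then \<open>r - 1\<close>, ..., \<open>1\<close>, and finally
  those with a minimal entry \<open>0\<close>. From a surviving tuple one could lower entry \<open>0\<close>, and
  independently raise the entries \<open>1, \<dots>, r\<close> in this order, each staying below the next one; the two
  results would intertwine.\<close>

lemma card_nonintertwining:
  fixes G :: "(nat \<Rightarrow> 'a::linorder) set"
  assumes G: "G \<subseteq> {..r} \<rightarrow>\<^sub>E X" and X: "finite X"
    and mono: "\<And>f. f \<in> G \<Longrightarrow> strict_mono_on {..r} f"
    and non: "\<And>f g. f \<in> G \<Longrightarrow> g \<in> G \<Longrightarrow>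
      \<not> ((\<forall>i\<le>r. f i < g i) \<and> (\<forall>i<r. g i < f (Suc i)))"
  shows "card G \<le> Suc r * card X ^ r"
proof -
  \<comment> \<open>\<open>F\<close> is what survives the deletions in entries \<open>r\<close> down
    to \<open>Suc m\<close>, each costing at most \<open>card X ^ r\<close> tuples. The witness
    \<open>g\<close> agrees with \<open>f\<close> up to \<open>m\<close> and is raised afterwards,
    staying below the next entry of \<open>f\<close>.\<close>
  have step: "\<exists>F\<subseteq>G. card G \<le> card F + (r - m) * card X ^ r \<and>
    (\<forall>f\<in>F. \<exists>g\<in>G. (\<forall>i\<le>m. g i = f i) \<and> (\<forall>i. m < i \<and> i \<le> r \<longrightarrow> f i < g i)
      \<and> (\<forall>i. m < i \<and> i < r \<longrightarrow> g i < f (Suc i)))" if "m \<le> r" for m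
    using that
  proof (induction m rule: inc_induct)
    case base
    show ?case
      by (intro exI[of _ G]) auto
  next
    case (step m)
    let ?i = "Suc m"
    from step.IH obtain F where F: "F \<subseteq> G" "card G \<le> card F + (r - ?i) * card X ^ r"
      and Z: "\<And>f. f \<in> F \<Longrightarrow> \<exists>g\<in>G. (\<forall>i\<le>?i. g i = f i) \<and>
        (\<forall>i. ?i < i \<and> i \<le> r \<longrightarrow> f i < g i) \<and> (\<forall>i. ?i < i \<and> i < r \<longrightarrow> g i < f (Suc i))"
      by blast
    let ?F = "{f \<in> F. \<exists>v. f ?i < v \<and> f(?i := v) \<in> F}"
    have "card F \<le> card ?F + card X ^ r"
      using F G step.hyps X by (intro card_le_peel) auto
    moreover have "r - m = Suc (r - ?i)"
      using step.hyps by simp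
    ultimately have "card G \<le> card ?F + (r - m) * card X ^ r"
      using F by simp
    moreover have "\<exists>g\<in>G. (\<forall>i\<le>m. g i = f i) \<and> (\<forall>i. m < i \<and> i \<le> r \<longrightarrow> f i < g i) \<and>
        (\<forall>i. m < i \<and> i < r \<longrightarrow> g i < f (Suc i))" if f: "f \<in> ?F" for f
    proof -
      obtain v where v: "f ?i < v" "f(?i := v) \<in> F"
        using f by blast
      obtain g where g: "g \<in> G" "\<And>i. i \<le> ?i \<Longrightarrow> g i = (f(?i := v)) i"
        "\<And>i. ?i < i \<Longrightarrow> i \<le> r \<Longrightarrow> (f(?i := v)) i < g i"
        "\<And>i. ?i < i \<Longrightarrow> i < r \<Longrightarrow> g i < (f(?i := v)) (Suc i)"
        using Z[OF v(2)] by blast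
      \<comment> \<open>The tuple with the raised entry belongs to \<open>F\<close>, so it is itself
        strictly increasing.\<close>
      have "v < f (Suc ?i)" if "?i < r"
      proof -
        have "strict_mono_on {..r} (f(?i := v))"
          using mono v F by blast
        then have "(f(?i := v)) ?i < (f(?i := v)) (Suc ?i)"
          by (rule strict_mono_onD) (use that in auto)
        then show ?thesis
          by simp
      qed
      moreover have gi: "g ?i = v"
        using g(2)[of ?i] by simp
      moreover have "g i < f (Suc i)" if "?i < i" "i < r" for i
        using g(4)[OF that] that by simp
      ultimately have "g i < f (Suc i)" if "m < i" "i < r" for i
        using that by (metis Suc_lessI)
      moreover have "f i < g i" if "?i < i" "i \<le> r" for i
        using g(3)[OF that] that by simp
      then have "f i < g i" if "m < i" "i \<le> r" for i
        using that v(1) gi by (metis Suc_lessI)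
      moreover have "g i = f i" if "i \<le> m" for i
        using g(2)[of i] that by simp
      ultimately show ?thesis
        using g(1) by blast
    qed
    ultimately show ?case
      using F by (intro exI[of _ ?F]) blast
  qed
  from step[of 0] obtain F where F: "F \<subseteq> G" "card G \<le> card F + r * card X ^ r"
      and Z: "\<And>f. f \<in> F \<Longrightarrow> \<exists>g\<in>G. (\<forall>i\<le>0. g i = f i) \<and>
        (\<forall>i. 0 < i \<and> i \<le> r \<longrightarrow> f i < g i) \<and> (\<forall>i. 0 < i \<and> i < r \<longrightarrow> g i < f (Suc i))"
    by auto
  let ?F = "{f \<in> F. \<exists>v. v < f 0 \<and> f(0 := v) \<in> F}"
  have "card F \<le> card ?F + card X ^ r"
    using F G X by (intro card_le_peel[where R = "\<lambda>x y. y < x"]) auto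
  \<comment> \<open>A lowered tuple \<open>f(0 := v)\<close> would intertwine with \<open>g\<close>:
    first \<open>v < f 0 = g 0 < f 1\<close>, then the raised entries alternate with those of
    \<open>f\<close>.\<close>
  moreover have "?F = {}"
  proof (rule ccontr)
    assume "?F \<noteq> {}"
    then obtain f v where v: "f \<in> F" "v < f 0" "f(0 := v) \<in> F"
      by blast
    obtain g where g: "g \<in> G" "g 0 = f 0" "\<And>i. 0 < i \<Longrightarrow> i \<le> r \<Longrightarrow> f i < g i"
      "\<And>i. 0 < i \<Longrightarrow> i < r \<Longrightarrow> g i < f (Suc i)"
      using Z[OF v(1)] by blast
    have "(f(0 := v)) i < g i" if "i \<le> r" for i
      using that v g by (cases "i = 0") auto
    moreover have "g i < (f(0 := v)) (Suc i)" if "i < r" for i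
    proof (cases "i = 0")
      case True
      have "f 0 < f (Suc 0)"
        using mono v(1) F that by (intro strict_mono_onD[of "{..r}" f]) auto
      with True g(2) show ?thesis
        by simp
    next
      case False
      with g(4)[of i] that show ?thesis
        by simp
    qed
    ultimately show False
      using non[of "f(0 := v)" g] v(3) g(1) F(1) by blast
  qed
  ultimately show ?thesis
    using F(2) by simp
qed

section \<open>Triangulations\<close>

text \<open>The intersection is a common face. If it is nonempty, one of its extreme points is
  extreme in both hulls and so lies in both generating sets.\<close>

lemma simplicial_complex_disjoint_hulls:
  assumes T: "simplicial_complex \<T>" "convex hull Y \<in> \<T>" "convex hull Z \<in> \<T>"
    and "finite Y" "finite Z" "Y \<inter> Z = {}"
  shows "convex hull Y \<inter> convex hull Z = {}"
proof (rule ccontr)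
  let ?F = "convex hull Y \<inter> convex hull Z"
  assume "?F \<noteq> {}"
  moreover have "compact ?F" "convex ?F"
    using assms by (auto intro!: compact_Int finite_imp_compact_convex_hull convex_Int)
  ultimately obtain v where v: "v extreme_point_of ?F"
    using extreme_point_exists_convex by blast
  have "?F face_of convex hull Y" "?F face_of convex hull Z"
    using T unfolding simplicial_complex_def by (metis, metis Int_commute)
  with v have "v extreme_point_of convex hull Y" "v extreme_point_of convex hull Z"
    using extreme_point_of_face by blast+
  then have "v \<in> Y \<inter> Z"
    using extreme_point_of_convex_hull by blast
  with assms show False
    by simp
qed

lemma simplicial_complex_subface:
  fixes C :: "'a::euclidean_space set"
  assumes "simplicial_complex \<T>" "convex hull C \<in> \<T>" "\<not> affine_dependent C" "D \<subseteq> C"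
  shows "convex hull D \<in> \<T>"
proof -
  have "convex hull D face_of convex hull C"
    using assms by (auto simp: face_of_convex_hull_affine_independent)
  with assms show ?thesis
    unfolding simplicial_complex_def by blast
qed

text \<open>The simplices with empty interior have a union with empty interior, so the closed union
  of the others already covers \<open>convex hull P\<close>. A relative interior point of
  \<open>S\<close> thus lies in a full-dimensional simplex \<open>R\<close>, and the common face of
  \<open>S\<close> and \<open>R\<close> must be all of \<open>S\<close>.\<close>

lemma triangulation_face_in_full_simplex:
  fixes P :: "'a::euclidean_space set"
  assumes T: "triangulation_of \<T> P" and P: "finite P" "interior (convex hull P) \<noteq> {}"
    and S: "S \<in> \<T>" "S \<noteq> {}"
  obtains C where "C \<subseteq> P" "\<not> affine_dependent C" "card C = Suc DIM('a)"
    "convex hull C \<in> \<T>" "S face_of convex hull C"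
proof -
  have sc: "simplicial_complex \<T>" and cover: "\<Union>\<T> = convex hull P"
    using T by (auto simp: triangulation_of_def)
  have fin: "finite \<T>"
    using sc by (simp add: simplicial_complex_def)
  \<comment> \<open>Each simplex has affinely independent vertices and is also a hull of points of
    \<open>P\<close>; being extreme, its vertices must belong to \<open>P\<close>.\<close>
  have hulls: "\<And>R. R \<in> \<T> \<Longrightarrow> \<exists>C\<subseteq>P. \<not> affine_dependent C \<and> R = convex hull C"
  proof -
    fix R assume R: "R \<in> \<T>"
    then obtain C where C: "\<not> affine_dependent C" "R = convex hull C"
      using sc by (auto simp: simplicial_complex_def simplex_def)
    obtain D where D: "D \<subseteq> P" "R = convex hull D"
      using triangulation_of_subset[OF T] R by blast
    have "C \<subseteq> D"
    proof
      fix v assume "v \<in> C"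
      with C D have "v extreme_point_of convex hull D"
        by (metis extreme_point_of_convex_hull_affine_independent)
      then show "v \<in> D"
        by (rule extreme_point_of_convex_hull)
    qed
    with C D show "\<exists>C\<subseteq>P. \<not> affine_dependent C \<and> R = convex hull C"
      by blast
  qed
  have closed: "closed R" if "R \<in> \<T>" for R
    using hulls[OF that] P(1)
    by (metis compact_imp_closed finite_imp_compact_convex_hull finite_subset)
  define \<F> where "\<F> = {R \<in> \<T>. interior R \<noteq> {}}"
  have "finite \<F>" "\<F> \<subseteq> \<T>"
    using fin by (auto simp: \<F>_def)
  have "closed (\<Union>\<F>)"
    using fin closed by (intro closed_Union) (auto simp: \<F>_def)
  have "interior (\<Union>\<G>) = {}" if "finite \<G>" "\<G> \<subseteq> \<T> - \<F>" for \<G>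
    using that
  proof (induction \<G>)
    case (insert R \<G>)
    then have "closed R" "interior R = {}" "interior (\<Union>\<G>) = {}"
      by (auto intro: closed simp: \<F>_def)
    then show ?case
      by (simp add: interior_closed_Un_empty_interior)
  qed simp
  then have "interior (\<Union>(\<T> - \<F>)) = {}"
    using fin by blast
  then have "interior (convex hull P) = interior (\<Union>\<F>)"
    using interior_closed_Un_empty_interior[OF \<open>closed (\<Union>\<F>)\<close>, of "\<Union>(\<T> - \<F>)"] \<open>\<F> \<subseteq> \<T>\<close>
    by (simp add: Un_absorb1 flip: cover Union_Un_distrib)
  then have "interior (convex hull P) \<subseteq> \<Union>\<F>"
    using interior_subset by blast
  then have "closure (interior (convex hull P)) \<subseteq> \<Union>\<F>"
    using \<open>closed (\<Union>\<F>)\<close> by (rule closure_minimal)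
  then have "convex hull P \<subseteq> \<Union>\<F>"
    using P(2) closure_subset by (simp add: convex_closure_interior) blast
  moreover have "convex S"
    using hulls[OF S(1)] by auto
  then obtain x where x: "x \<in> rel_interior S"
    using S(2) by (metis ex_in_conv rel_interior_eq_empty)
  moreover have "rel_interior S \<subseteq> convex hull P"
    using S(1) cover rel_interior_subset[of S] by blast
  ultimately obtain R where R: "R \<in> \<F>" "x \<in> R"
    by blast
  then have "R \<in> \<T>"
    by (simp add: \<F>_def)
  then have "(S \<inter> R) face_of S" "(S \<inter> R) face_of R"
    using sc S(1) unfolding simplicial_complex_def by (metis, metis Int_commute)
  moreover have "S \<subseteq> S \<inter> R"
  proof (rule subset_of_face_of)
    show "(S \<inter> R) face_of S"
      by fact
    show "S \<inter> R \<inter> rel_interior S \<noteq> {}"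
      using x R rel_interior_subset by blast
  qed simp
  ultimately have "S face_of R"
    by (simp add: Int_absorb2)
  obtain C where C: "C \<subseteq> P" "\<not> affine_dependent C" "R = convex hull C"
    using hulls[OF \<open>R \<in> \<T>\<close>] by blast
  have "finite C"
    using C P(1) finite_subset by blast
  moreover have "interior (convex hull C) \<noteq> {}"
    using R C by (simp add: \<F>_def)
  ultimately have "card C > DIM('a)"
    using empty_interior_convex_hull[of C] by force
  moreover have "card C \<le> Suc DIM('a)"
    using affine_independent_iff_card[of C] C(2) aff_dim_le_DIM[of C]
    by linarith
  ultimately show thesis
    using C \<open>R \<in> \<T>\<close> \<open>S face_of R\<close> by (intro that[of C]) auto
qed

section \<open>Upper bound for triangulations of points on the curve\<close>

text \<open>Simplices are recorded by their parameters to make the order along the curve available.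
  Affine independence ensures that the subsets span faces in the complex.\<close>

definition simplex_params :: "(real ^ 'n::{finite,linorder}) set set \<Rightarrow> real set \<Rightarrow> real set set"
  where "simplex_params \<T> X = {A. A \<subseteq> X \<and> \<not> affine_dependent (moment_curve ` A :: (real ^ 'n::{finite,linorder}) set)
    \<and> convex hull (moment_curve ` A) \<in> \<T>}"

text \<open>The points with even and with odd positions span faces in the complex without common
  vertices. These faces are disjoint, whereas alternating hulls meet.\<close>

lemma simplex_params_not_alternating:
  fixes \<T> :: "(real ^ 'n::{finite,linorder}) set set"
  assumes T: "simplicial_complex \<T>"
    and AB: "A \<in> simplex_params \<T> X" "B \<in> simplex_params \<T> X"
    and mono: "strict_mono_on {..Suc CARD('n)} w"
    and even: "\<And>k. k \<le> Suc CARD('n) \<Longrightarrow> even k \<Longrightarrow> w k \<in> A"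
    and odd: "\<And>k. k \<le> Suc CARD('n) \<Longrightarrow> odd k \<Longrightarrow> w k \<in> B"
  shows False
proof -
  let ?E = "{k. k \<le> Suc CARD('n) \<and> even k}" and ?O = "{k. k \<le> Suc CARD('n) \<and> odd k}"
  let ?c = "moment_curve :: real \<Rightarrow> real ^ 'n::{finite,linorder}"
  have "?c ` w ` ?E \<subseteq> ?c ` A" "?c ` w ` ?O \<subseteq> ?c ` B"
    using even odd by blast+
  then have "convex hull (?c ` w ` ?E) \<in> \<T>" "convex hull (?c ` w ` ?O) \<in> \<T>"
    using AB simplicial_complex_subface[OF T] unfolding simplex_params_def by blast+
  moreover have "?c ` w ` ?E \<inter> ?c ` w ` ?O = {}"
  proof -
    have "inj_on w {..Suc CARD('n)}"
      using mono by (rule strict_mono_on_imp_inj_on)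
    then have "w ` ?E \<inter> w ` ?O = w ` (?E \<inter> ?O)"
      by (intro inj_on_image_Int[symmetric]) auto
    also have "?E \<inter> ?O = {}"
      by auto
    finally have "?c ` (w ` ?E \<inter> w ` ?O) = {}"
      by simp
    then show ?thesis
      by (simp only: image_Int[OF inj_moment_curve])
  qed
  ultimately have "convex hull (?c ` w ` ?E) \<inter> convex hull (?c ` w ` ?O) = {}"
    by (intro simplicial_complex_disjoint_hulls[OF T]) auto
  with alternating_hulls_meet[OF mono] show False
    by blast
qed

lemma strict_mono_on_sorted_list_nth:
  fixes A :: "'a::linorder set"
  assumes "finite A" "card A = Suc m"
  shows "strict_mono_on {..m} ((!) (sorted_list_of_set A))"
    "(!) (sorted_list_of_set A) ` {..m} = A"
proof -
  show "strict_mono_on {..m} ((!) (sorted_list_of_set A))"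
    using assms by (intro strict_mono_onI) (simp add: sorted_wrt_nth_less[OF strict_sorted_list_of_set])
  show "(!) (sorted_list_of_set A) ` {..m} = A"
    using nth_image[of "Suc m" "sorted_list_of_set A"] assms by (simp add: lessThan_Suc_atMost atLeast0LessThan)
qed

lemma strict_mono_on_atMost_SucI:
  fixes f :: "nat \<Rightarrow> 'a::order"
  assumes "\<And>k. k < m \<Longrightarrow> f k < f (Suc k)"
  shows "strict_mono_on {..m} f"
proof (rule strict_mono_onI)
  fix i j :: nat
  assume "i < j" "j \<in> {..m}"
  then show "f i < f j"
  proof (induction j)
    case (Suc j)
    then show ?case
      using assms[of j] by (cases "i = j") (auto intro: less_trans)
  qed simp
qed

text \<open>Mapping a sorted parameter set to its entries of even index is injective and yields
  non-intertwining tuples: either failure produces \<open>2 * r + 2\<close> parameters alternating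
  between two simplices.\<close>

lemma card_full_simplex_params:
  fixes \<T> :: "(real ^ 'n::{finite,linorder}) set set"
  assumes T: "simplicial_complex \<T>" and X: "finite X" and n: "CARD('n) = 2 * r"
  shows "card {A \<in> simplex_params \<T> X. card A = Suc (2 * r)} \<le> Suc r * card X ^ r"
proof -
  let ?K = "simplex_params \<T> X"
  let ?F = "{A \<in> ?K. card A = Suc (2 * r)}"
  let ?e = "\<lambda>A :: real set. (!) (sorted_list_of_set A)"
  let ?E = "\<lambda>A. \<lambda>i\<in>{..r}. ?e A (2 * i)"
  have AX: "A \<subseteq> X" if "A \<in> ?F" for A
    using that by (simp add: simplex_params_def)
  have mono: "strict_mono_on {..2 * r} (?e A)" and img: "?e A ` {..2 * r} = A" if "A \<in> ?F" for A
    using that finite_subset[OF AX[OF that] X] by (intro strict_mono_on_sorted_list_nth; simp)+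
  have mem: "?e A k \<in> A" if "A \<in> ?F" "k \<le> 2 * r" for A k
    using img[OF that(1)] that(2) by blast
  have even_eq: "?e A k = ?e B k" if "?E A = ?E B" "k \<le> 2 * r" "even k" for A B k
    using fun_cong[OF that(1), of "k div 2"] that(2,3) by auto
  have no_less: False
    if A: "A \<in> ?F" and B: "B \<in> ?F" and eq: "?E A = ?E B" and k: "k \<le> 2 * r" "?e A k < ?e B k"
    for A B k
  proof -
    have "odd k"
      using even_eq[OF eq k(1)] k(2) by auto
    \<comment> \<open>The shared entries of even index serve as elements of \<open>B\<close> up to \<open>k\<close> and, shifted to odd
      positions, as elements of \<open>A\<close> afterwards.\<close>
    define w where "w j = (if j \<le> k then ?e A j else ?e B (j - 1))" for j
    show False
    proof (rule simplex_params_not_alternating[OF T, of B X A w])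
      show "B \<in> ?K" "A \<in> ?K"
        using A B by auto
      show "strict_mono_on {..Suc CARD('n)} w"
      proof (rule strict_mono_on_atMost_SucI)
        fix j assume j: "j < Suc CARD('n)"
        consider "j < k" | "j = k" | "k < j"
          by linarith
        then show "w j < w (Suc j)"
        proof cases
          case 1
          then show ?thesis
            using k by (auto simp: w_def intro!: strict_mono_onD[OF mono[OF A]])
        next
          case 2
          then show ?thesis
            using k by (simp add: w_def)
        next
          case 3
          then show ?thesis
            using j n by (auto simp: w_def intro!: strict_mono_onD[OF mono[OF B]])
        qed
      qed
    next
      fix j assume j: "j \<le> Suc CARD('n)" "even j"
      with k n \<open>odd k\<close> show "w j \<in> B"
        using even_eq[OF eq, of j] mem[OF B, of j] mem[OF B, of "j - 1"] by (auto simp: w_def)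
    next
      fix j assume j: "j \<le> Suc CARD('n)" "odd j"
      with k n \<open>odd k\<close> show "w j \<in> A"
        using even_eq[OF eq, of "j - 1"] mem[OF A, of j] mem[OF A, of "j - 1"] by (auto simp: w_def)
    qed
  qed
  have inj: "inj_on ?E ?F"
  proof (rule inj_onI)
    fix A B assume AB: "A \<in> ?F" "B \<in> ?F" "?E A = ?E B"
    have "?e A k = ?e B k" if "k \<le> 2 * r" for k
      using no_less[OF AB that] no_less[OF AB(2,1) AB(3)[symmetric] that] by (meson linorder_cases)
    then have "?e A ` {..2 * r} = ?e B ` {..2 * r}"
      by simp
    then show "A = B"
      using img AB by simp
  qed
  have "card (?E ` ?F) \<le> Suc r * card X ^ r"
  proof (rule card_nonintertwining[OF _ X])
    show "?E ` ?F \<subseteq> {..r} \<rightarrow>\<^sub>E X"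
      using mem AX by fastforce
  next
    fix f assume "f \<in> ?E ` ?F"
    then obtain A where A: "A \<in> ?F" "f = ?E A"
      by blast
    then show "strict_mono_on {..r} f"
      by (auto intro!: strict_mono_onI strict_mono_onD[OF mono[OF A(1)]])
  next
    fix f g assume "f \<in> ?E ` ?F" "g \<in> ?E ` ?F"
    then obtain A B where A: "A \<in> ?F" "f = ?E A" and B: "B \<in> ?F" "g = ?E B"
      by blast
    show "\<not> ((\<forall>i\<le>r. f i < g i) \<and> (\<forall>i<r. g i < f (Suc i)))"
    proof
      assume *: "(\<forall>i\<le>r. f i < g i) \<and> (\<forall>i<r. g i < f (Suc i))"
      \<comment> \<open>\<open>w\<close> runs through
        \<open>f 0 < g 0 < f 1 < ... < f r < g r\<close>, with even positions in \<open>A\<close>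
        and odd positions in \<open>B\<close>.\<close>
      define w where "w k = (if even k then f (k div 2) else g (k div 2))" for k
      show False
      proof (rule simplex_params_not_alternating[OF T, of A X B w])
        show "A \<in> ?K" "B \<in> ?K"
          using A B by auto
        show "strict_mono_on {..Suc CARD('n)} w"
          by (rule strict_mono_on_atMost_SucI) (use * n in \<open>auto simp: w_def elim!: oddE evenE\<close>)
      next
        fix k assume "k \<le> Suc CARD('n)" "even k"
        then show "w k \<in> A"
          using mem[OF A(1), of k] n A(2) by (auto simp: w_def)
      next
        fix k assume k: "k \<le> Suc CARD('n)" "odd k"
        then show "w k \<in> B"
          using mem[OF B(1), of "2 * (k div 2)"] n B(2) by (auto simp: w_def)
      qed
    qed
  qed
  then show ?thesis
    using inj by (simp add: card_image)
qed

text \<open>Every face counted here arises from a full-dimensional simplex by omitting one vertex,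
  so pairs of a simplex and a vertex suffice. The factor \<open>Suc (2 * r)\<close> is the number of
  vertices.\<close>

lemma num_faces_moment_curve_le:
  fixes \<T> :: "(real ^ 'n::{finite,linorder}) set set"
  assumes T: "triangulation_of \<T> (moment_curve ` X)" and X: "finite X" "card X > CARD('n)"
    and n: "CARD('n) = 2 * r"
  shows "num_faces (int CARD('n) - 1) \<T> \<le> Suc (2 * r) * (Suc r * card X ^ r)"
proof -
  let ?F = "{A \<in> simplex_params \<T> X. card A = Suc (2 * r)}"
  let ?c = "moment_curve :: real \<Rightarrow> real ^ 'n::{finite,linorder}"
  have sc: "simplicial_complex \<T>"
    using T by (simp add: triangulation_of_def)
  have finF: "finite ?F"
    using X by (auto simp: simplex_params_def intro!: finite_subset[of _ "Pow X"])
  have fin_mem: "finite A" if "A \<in> ?F" for A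
    using that X by (auto simp: simplex_params_def finite_subset)
  have "{S \<in> \<T>. (int CARD('n) - 1) simplex S} \<subseteq>
    (\<lambda>(A, a). convex hull (?c ` (A - {a}))) ` Sigma ?F (\<lambda>A. A)"
  proof
    fix S assume "S \<in> {S \<in> \<T>. (int CARD('n) - 1) simplex S}"
    then obtain D where S: "S \<in> \<T>" and D: "\<not> affine_dependent D" "card D = CARD('n)" "S = convex hull D"
      by (auto simp: simplex_def)
    have "S \<noteq> {}"
      using D by auto
    obtain C where C: "C \<subseteq> ?c ` X" "\<not> affine_dependent C" "card C = Suc CARD('n)"
      "convex hull C \<in> \<T>" "S face_of convex hull C"
      using triangulation_face_in_full_simplex[OF T _ interior_convex_hull_moment_curve[OF X] S \<open>S \<noteq> {}\<close>] X
      by auto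
    obtain C' where C': "C' \<subseteq> C" "S = convex hull C'"
      using C by (auto simp: face_of_convex_hull_affine_independent)
    have "\<not> affine_dependent C'"
      using C(2) C'(1) affine_independent_subset by blast
    \<comment> \<open>Both affinely independent sets span \<open>S\<close>, so comparing affine
      dimensions gives the vertex count of \<open>C'\<close>.\<close>
    then have "int (card C') = int (card D)"
      using D C'(2) aff_dim_convex_hull[of C'] aff_dim_convex_hull[of D]
      by (simp add: affine_independent_iff_card)
    then have "card C' = CARD('n)"
      using D by simp
    moreover have "finite C"
      using C X finite_subset by blast
    ultimately have "card (C - C') = 1"
      using C C' by (simp add: card_Diff_subset finite_subset)
    then obtain v where v: "C - C' = {v}"
      by (auto simp: card_1_singleton_iff)
    obtain A where A: "A \<subseteq> X" "C = ?c ` A"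
      using C(1) by (auto simp: subset_image_iff)
    obtain a where a: "a \<in> A" "v = ?c a"
      using v A by blast
    have "C' = C - {v}"
      using v C'(1) by blast
    then have "C' = ?c ` (A - {a})"
      using A a by (simp add: image_set_diff[OF inj_moment_curve])
    moreover have "card A = Suc (2 * r)"
      using C(3) A n by (simp add: card_moment_curve_image)
    then have "A \<in> ?F"
      using A C by (simp add: simplex_params_def)
    ultimately show "S \<in> (\<lambda>(A, a). convex hull (?c ` (A - {a}))) ` Sigma ?F (\<lambda>A. A)"
      using a C'(2) by (intro image_eqI[of _ _ "(A, a)"]) auto
  qed
  moreover have finS: "finite (Sigma ?F (\<lambda>A. A))"
    using finF fin_mem by (rule finite_SigmaI)
  ultimately have "num_faces (int CARD('n) - 1) \<T> \<le> card (Sigma ?F (\<lambda>A. A))"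
    unfolding num_faces_def by (rule surj_card_le[rotated])
  also have "\<dots> = (\<Sum>A\<in>?F. card A)"
    using finF fin_mem by (intro card_SigmaI) blast+
  also have "\<dots> = (\<Sum>A\<in>?F. Suc (2 * r))"
    by (rule sum.cong) auto
  also have "\<dots> = Suc (2 * r) * card ?F"
    by (simp only: sum_constant of_nat_id mult.commute)
  also have "\<dots> \<le> Suc (2 * r) * (Suc r * card X ^ r)"
    using card_full_simplex_params[OF sc X(1) n] by (rule mult_le_mono2)
  finally show ?thesis .
qed

lemma max_triangulation_facets_moment_curve_le:
  fixes P :: "(real ^ 'n::{finite,linorder}) set"
  assumes P: "finite P" "P \<subseteq> range moment_curve" "card P > CARD('n)" and n: "CARD('n) = 2 * r"
  shows "max_triangulation_facets P \<le> Suc (2 * r) * (Suc r * card P ^ r)"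
proof -
  obtain X where X: "finite X" "P = moment_curve ` X" "card X = card P"
    using P inj_moment_curve by (metis card_image finite_subset_image inj_on_subset subset_UNIV)
  let ?N = "num_faces (int CARD('n) - 1) ` {\<T>. triangulation_of \<T> P}"
  have le: "k \<le> Suc (2 * r) * (Suc r * card P ^ r)" if "k \<in> ?N" for k
    using that num_faces_moment_curve_le[of _ X, OF _ X(1) _ n] X P by auto
  show ?thesis
  \<comment> \<open>With no triangulation at all, the supremum is \<open>Sup {} = 0\<close> on the
    naturals.\<close>
  proof (cases "?N = {}")
    case True
    then show ?thesis
      by (simp add: max_triangulation_facets_def)
  next
    case False
    then show ?thesis
      using le by (auto simp: max_triangulation_facets_def intro!: cSup_least)
  qed
qed

section \<open>Blocking sets\<close>

text \<open>Every other chord has exactly one endpoint strictly inside \<open>s\<close>, and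
  crossing chords share no endpoint. Hence \<open>s\<close> has length at least
  \<open>card S\<close>, and each summand is at most \<open>1 / card S\<close>.\<close>

lemma sum_inverse_crossing_chords:
  fixes l u :: "'a \<Rightarrow> nat"
  assumes fin: "finite S"
    and less: "\<And>s. s \<in> S \<Longrightarrow> l s < u s"
    and cross: "\<And>s t. s \<in> S \<Longrightarrow> t \<in> S \<Longrightarrow> s \<noteq> t \<Longrightarrow>
      l s < l t \<and> l t < u s \<and> u s < u t \<or> l t < l s \<and> l s < u t \<and> u t < u s"
  shows "(\<Sum>s\<in>S. 1 / real (u s - l s)) \<le> 1"
proof (cases "S = {}")
  case False
  have long: "card S \<le> u s - l s" if s: "s \<in> S" for s
  proof -
    \<comment> \<open>This selects the endpoint of \<open>t\<close> that lies inside
      \<open>s\<close>.\<close>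
    let ?f = "\<lambda>t. if l s < l t then l t else u t"
    have "inj_on ?f (S - {s})"
    proof (rule inj_onI, rule ccontr)
      fix t t' assume t: "t \<in> S - {s}" "t' \<in> S - {s}" "?f t = ?f t'" "t \<noteq> t'"
      then show False
        using cross[of t t'] cross[of s t] cross[of s t'] s by (auto split: if_splits)
    qed
    moreover have "?f t \<in> {l s<..<u s}" if "t \<in> S - {s}" for t
      using that cross[of s t] s by auto
    then have "?f ` (S - {s}) \<subseteq> {l s<..<u s}"
      by blast
    ultimately have "card (S - {s}) \<le> card {l s<..<u s}"
      by (metis card_image card_mono finite_greaterThanLessThan)
    then show ?thesis
      using less[OF s] fin s by simp
  qed
  have "(\<Sum>s\<in>S. 1 / real (u s - l s)) \<le> (\<Sum>s\<in>S. 1 / real (card S))"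
  proof (rule sum_mono)
    fix s assume "s \<in> S"
    then show "1 / real (u s - l s) \<le> 1 / real (card S)"
      using long[of s] less[of s] fin False
      by (intro divide_left_mono mult_pos_pos) (auto simp: card_gt_0_iff)
  qed
  also have "\<dots> \<le> 1"
    using fin False by simp
  finally show ?thesis .
qed simp

section \<open>Neighbouring pairs together with a chord\<close>

text \<open>The elements are positions in the sorted list of parameters. Starting the pairs at even
  positions makes them disjoint for different elements of \<open>J\<close>.\<close>

definition chord_with_pairs :: "nat set \<Rightarrow> nat \<Rightarrow> nat \<Rightarrow> nat set"
  where "chord_with_pairs J y z = (\<Union>j\<in>J. {2 * j, Suc (2 * j)}) \<union> {y, z}"

lemma card_chord_with_pairs:
  assumes "J \<subseteq> {..<m}" "2 * m \<le> y" "y < z"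
  shows "card (chord_with_pairs J y z) = 2 * card J + 2"
proof -
  have "finite J"
    using assms finite_subset by blast
  moreover have "card (\<Union>j\<in>J. {2 * j, Suc (2 * j)}) = (\<Sum>j\<in>J. card {2 * j, Suc (2 * j)})"
    using \<open>finite J\<close> by (intro card_UN_disjoint) (auto simp: disjoint_iff; presburger)+
  moreover have "(\<Union>j\<in>J. {2 * j, Suc (2 * j)}) \<inter> {y, z} = {}"
    using assms by fastforce
  ultimately show ?thesis
    using assms by (simp add: chord_with_pairs_def card_Un_disjoint)
qed

text \<open>The positions below \<open>2 * m\<close> determine \<open>J\<close>, and the other two
  are the ends of the chord.\<close>

lemma chord_with_pairs_inject:
  assumes J: "J \<subseteq> {..<m}" "2 * m \<le> y" "y < z" and J': "J' \<subseteq> {..<m}" "2 * m \<le> y'" "y' < z'"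
    and eq: "chord_with_pairs J y z = chord_with_pairs J' y' z'"
  shows "J = J' \<and> y = y' \<and> z = z'"
proof -
  have low: "K = {j. j < m \<and> 2 * j \<in> chord_with_pairs K u v}" 
    and high: "{u, v} = chord_with_pairs K u v - {..<2 * m}"
    if "K \<subseteq> {..<m}" "2 * m \<le> u" "u < v" for K u v
    using that by (auto simp: chord_with_pairs_def; presburger)+
  show ?thesis
    using low[OF J] low[OF J'] high[OF J] high[OF J'] J(3) J'(3) unfolding eq
    by (metis doubleton_eq_iff less_asym)
qed

text \<open>A polynomial of degree at most \<open>2 * card J + 2\<close> vanishes on the first set
  and is nonpositive on the second, whose positions avoid the inside of the first chord. The common
  point \<open>q\<close> forces it to vanish on the second set too.\<close>

lemma chord_with_pairs_subset:
  fixes q :: "real ^ 'n::{finite,linorder}" and x :: "nat \<Rightarrow> real"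
  assumes x: "strict_mono_on {..N} x" and dim: "2 * card J + 2 \<le> CARD('n)"
    and J: "J \<subseteq> {..<m}" "2 * m \<le> y" "y < z" "z \<le> N"
    and J': "J' \<subseteq> {..<m}" "y' < z'" "z' \<le> N"
    and outside: "y' \<notin> {y<..<z}" "z' \<notin> {y<..<z}"
    and q: "q \<in> convex hull (moment_curve ` x ` chord_with_pairs J y z)"
      "q \<in> rel_interior (convex hull (moment_curve ` x ` chord_with_pairs J' y' z'))"
  shows "chord_with_pairs J' y' z' \<subseteq> chord_with_pairs J y z"
proof -
  have finJ: "finite J"
    using J finite_subset by blast
  \<comment> \<open>No point of the curve lies between two neighbours, so among the points of \<open>P\<close> only those
    inside the chord have positive values.\<close>
  define p where "p = - ([:- x y, 1:] * [:- x z, 1:]) *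
    (\<Prod>j\<in>J. [:- x (2 * j), 1:] * [:- x (Suc (2 * j)), 1:])"
  have poly_p: "poly p t = - ((t - x y) * (t - x z)) *
      (\<Prod>j\<in>J. (t - x (2 * j)) * (t - x (Suc (2 * j))))" for t
    by (simp add: p_def poly_prod algebra_simps)
  have "degree p \<le> 2 + (\<Sum>j\<in>J. 2)"
    unfolding p_def
    by (intro order.trans[OF degree_mult_le] add_mono order.trans[OF degree_prod_sum_le] sum_mono finJ)
      (auto intro!: order.trans[OF degree_mult_le])
  then have deg: "degree p \<le> CARD('n)"
    using dim by simp
  have less: "x i < x j \<longleftrightarrow> i < j" if "i \<le> N" "j \<le> N" for i j
    using x that by (simp add: strict_mono_on_less)
  have le: "x i \<le> x j \<longleftrightarrow> i \<le> j" if "i \<le> N" "j \<le> N" for i j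
    using less[OF that(2,1)] by (simp add: not_less flip: linorder_not_le)
  have eq: "x i = x j \<longleftrightarrow> i = j" if "i \<le> N" "j \<le> N" for i j
    using le[OF that] le[OF that(2,1)] by auto
  have pair_le: "Suc (2 * j) \<le> N" if "j \<in> J" for j
  proof -
    have "j < m"
      using that J by auto
    then show ?thesis
      using J by simp
  qed
  have zero: "poly p (x k) = 0 \<longleftrightarrow> k \<in> chord_with_pairs J y z" if "k \<le> N" for k
  proof -
    have "poly p (x k) = 0 \<longleftrightarrow> x k = x y \<or> x k = x z \<or>
        (\<exists>j\<in>J. x k = x (2 * j) \<or> x k = x (Suc (2 * j)))"
      using finJ by (auto simp: poly_p)
    also have "\<dots> \<longleftrightarrow> k \<in> chord_with_pairs J y z"
      using J pair_le that by (auto simp: chord_with_pairs_def eq Suc_leD)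
    finally show ?thesis .
  qed
  have nonpos: "poly p (x k) \<le> 0" if "k \<le> N" "k \<notin> {y<..<z}" for k
  proof -
    have "0 \<le> (x k - x y) * (x k - x z)"
      using that J by (cases "k \<le> y") (auto simp: zero_le_mult_iff le)
    moreover have "0 \<le> (x k - x (2 * j)) * (x k - x (Suc (2 * j)))" if "j \<in> J" for j
      using pair_le[OF that] \<open>k \<le> N\<close> by (cases "k \<le> 2 * j") (auto simp: zero_le_mult_iff le)
    ultimately show ?thesis
      by (simp add: poly_p mult_nonneg_nonneg prod_nonneg)
  qed
  have J'_le: "k \<le> N" "k \<notin> {y<..<z}" if "k \<in> chord_with_pairs J' y' z'" for k
  proof -
    have "k < 2 * m \<or> k \<in> {y', z'}"
      using that J'(1) by (fastforce simp: chord_with_pairs_def)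
    then show "k \<le> N" "k \<notin> {y<..<z}"
      using J J' outside by auto
  qed
  show ?thesis
  proof
    fix k assume k: "k \<in> chord_with_pairs J' y' z'"
    have "poly p (x k) = 0"
    proof (rule poly_vanishes_on_hull_meeting_rel_interior[OF deg _ _ q])
      fix t assume "t \<in> x ` chord_with_pairs J y z"
      moreover have "i \<le> N" if "i \<in> chord_with_pairs J y z" for i
        using that J pair_le by (auto simp: chord_with_pairs_def dest: Suc_leD)
      ultimately show "poly p t = 0"
        using zero by auto
    qed (use k nonpos J'_le in auto)
    then show "k \<in> chord_with_pairs J y z"
      using zero J'_le[OF k] by simp
  qed
qed

text \<open>If two chords do not cross, one has no endpoint strictly inside the other, so one set
  contains the other. Equal cardinalities then make the sets, and hence the triples, equal.\<close>

lemma chord_with_pairs_cross: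
  fixes q :: "real ^ 'n::{finite,linorder}" and x :: "nat \<Rightarrow> real"
  assumes x: "strict_mono_on {..N} x" and dim: "2 * card J + 2 = CARD('n)" "card J' = card J"
    and J: "J \<subseteq> {..<m}" "2 * m \<le> y" "y < z" "z \<le> N"
    and J': "J' \<subseteq> {..<m}" "2 * m \<le> y'" "y' < z'" "z' \<le> N"
    and q: "q \<in> rel_interior (convex hull (moment_curve ` x ` chord_with_pairs J y z))"
      "q \<in> rel_interior (convex hull (moment_curve ` x ` chord_with_pairs J' y' z'))"
    and neq: "(J, y, z) \<noteq> (J', y', z')"
  shows "y < y' \<and> y' < z \<and> z < z' \<or> y' < y \<and> y < z' \<and> z' < z"
proof (rule ccontr)
  let ?A = "chord_with_pairs J y z" and ?B = "chord_with_pairs J' y' z'"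
  assume "\<not> ?thesis"
  then have "y' \<notin> {y<..<z} \<and> z' \<notin> {y<..<z} \<or> y \<notin> {y'<..<z'} \<and> z \<notin> {y'<..<z'}"
    using J J' by auto
  moreover have "q \<in> convex hull (moment_curve ` x ` ?A)" "q \<in> convex hull (moment_curve ` x ` ?B)"
    using q rel_interior_subset by blast+
  ultimately have "?B \<subseteq> ?A \<or> ?A \<subseteq> ?B"
    using chord_with_pairs_subset[OF x, of J m y z J' y' z' q]
      chord_with_pairs_subset[OF x, of J' m y' z' J y z q] dim J J' q by auto
  moreover have "card ?A = card ?B"
    using J J' dim by (simp add: card_chord_with_pairs)
  moreover have "finite ?A" "finite ?B"
    using J J' by (auto simp: chord_with_pairs_def intro: finite_subset)
  ultimately have "?A = ?B"
    by (metis card_subset_eq)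
  then show False
    using chord_with_pairs_inject[OF J(1-3) J'(1-3)] neq by simp
qed

section \<open>Weighted counting of blocking points\<close>

text \<open>Each set is assigned to one point of \<open>Q\<close> blocking it. The sets assigned to
  the same point have pairwise crossing chords, so their weights sum to at most 1, and
  \<open>card Q\<close> bounds the total weight.\<close>

lemma card_blocking_set_ge:
  fixes Q :: "(real ^ 'n::{finite,linorder}) set" and X :: "real set"
  assumes X: "finite X" "X \<noteq> {}" and n: "CARD('n) = 2 * r" and r: "r \<ge> 1"
    and Q: "finite Q" "blocks Q (moment_curve ` X)" and m: "4 * m \<le> card X"
  shows "real (m choose (r - 1)) * (real m * harm m) \<le> real (card Q)"
proof -
  obtain N where N: "card X = Suc N"
    using X by (metis card_0_eq not0_implies_Suc)
  define x where "x = (!) (sorted_list_of_set X)"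
  have x: "strict_mono_on {..N} x" "x ` {..N} = X"
    unfolding x_def using strict_mono_on_sorted_list_nth[OF X(1) N] .
  define \<J> where "\<J> = {J. J \<subseteq> {..<m} \<and> card J = r - 1}"
  \<comment> \<open>A triple holds the pairs, the start of the chord and its length. The last
    position is at most \<open>4 * m - 1\<close>, which is at most \<open>N\<close>, and
    \<open>r - 1\<close> pairs with a chord give \<open>2 * r\<close> points.\<close>
  define I where "I = \<J> \<times> {2 * m..<3 * m} \<times> {1..m}"
  have "finite \<J>"
    by (simp add: \<J>_def)
  then have "finite I"
    by (simp add: I_def)
  let ?A = "\<lambda>(J, y, k). moment_curve ` x ` chord_with_pairs J y (y + k) :: (real ^ 'n::{finite,linorder}) set"
  have I: "J \<subseteq> {..<m}" "card J = r - 1" "2 * m \<le> y" "y < y + k" "y + k \<le> N" if "(J, y, k) \<in> I" for J y k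
    using that m N by (auto simp: I_def \<J>_def)
  have "\<exists>q\<in>Q. q \<in> rel_interior (convex hull ?A i)" if "i \<in> I" for i
  proof -
    obtain J y k where i: "i = (J, y, k)"
      by (metis prod_cases3)
    note * = I[OF that[unfolded i]]
    have sub: "chord_with_pairs J y (y + k) \<subseteq> {..N}"
    proof
      fix l assume "l \<in> chord_with_pairs J y (y + k)"
      then have "l < 2 * m \<or> l \<in> {y, y + k}"
        using *(1) by (fastforce simp: chord_with_pairs_def)
      with * show "l \<in> {..N}"
        by auto
    qed
    then have "?A i \<subseteq> moment_curve ` X"
      using x(2) i by auto
    moreover have "card (?A i) = card (chord_with_pairs J y (y + k))"
      using inj_on_subset[OF strict_mono_on_imp_inj_on[OF x(1)] sub]
      by (simp add: i card_moment_curve_image card_image)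
    then have "card (?A i) = DIM(real ^ 'n::{finite,linorder})"
      using card_chord_with_pairs[OF *(1,3,4)] * n r by simp
    ultimately show ?thesis
      using Q(2) unfolding blocks_def by blast
  qed
  then have "\<forall>i\<in>I. \<exists>q. q \<in> Q \<and> q \<in> rel_interior (convex hull ?A i)"
    by blast
  from bchoice[OF this] obtain f
    where f: "\<And>i. i \<in> I \<Longrightarrow> f i \<in> Q \<and> f i \<in> rel_interior (convex hull ?A i)"
    by blast
  let ?w = "\<lambda>(J, y, k). 1 / real (y + k - y)"
  \<comment> \<open>There are \<open>m choose (r - 1)\<close> choices of pairs and \<open>m\<close>
    starts; summing \<open>1 / k\<close> over the lengths gives \<open>harm m\<close>.\<close>
  have "real (m choose (r - 1)) * (real m * harm m) = (\<Sum>i\<in>I. ?w i)"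
    by (simp add: I_def harm_def inverse_eq_divide \<J>_def n_subsets flip: sum.cartesian_product)
  also have "\<dots> = (\<Sum>q\<in>Q. \<Sum>i\<in>{i \<in> I. f i = q}. ?w i)"
    using \<open>finite I\<close> Q(1) f by (intro sum.group[symmetric]) auto
  also have "\<dots> \<le> (\<Sum>q\<in>Q. 1)"
  proof (rule sum_mono)
    fix q assume "q \<in> Q"
    have "(\<Sum>i\<in>{i \<in> I. f i = q}. 1 / real ((\<lambda>(J, y, k). y + k) i - (\<lambda>(J, y, k). y) i)) \<le> 1"
    proof (rule sum_inverse_crossing_chords)
      fix s t assume st: "s \<in> {i \<in> I. f i = q}" "t \<in> {i \<in> I. f i = q}" "s \<noteq> t"
      obtain J y k J' y' k' where eq: "s = (J, y, k)" "t = (J', y', k')"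
        by (metis prod_cases3)
      note A = I[of J y k] and B = I[of J' y' k']
      have "y < y' \<and> y' < y + k \<and> y + k < y' + k' \<or> y' < y \<and> y < y' + k' \<and> y' + k' < y + k"
      proof (rule chord_with_pairs_cross[OF x(1), of J J' m])
        show "q \<in> rel_interior (convex hull (moment_curve ` x ` chord_with_pairs J y (y + k)))"
          using f[of s] st eq by simp
        show "q \<in> rel_interior (convex hull (moment_curve ` x ` chord_with_pairs J' y' (y' + k')))"
          using f[of t] st eq by simp
      qed (use A B st eq n r in auto)
      then show "(case s of (J, y, k) \<Rightarrow> y) < (case t of (J, y, k) \<Rightarrow> y) \<and>
          (case t of (J, y, k) \<Rightarrow> y) < (case s of (J, y, k) \<Rightarrow> y + k) \<and>
          (case s of (J, y, k) \<Rightarrow> y + k) < (case t of (J, y, k) \<Rightarrow> y + k) \<or>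
          (case t of (J, y, k) \<Rightarrow> y) < (case s of (J, y, k) \<Rightarrow> y) \<and>
          (case s of (J, y, k) \<Rightarrow> y) < (case t of (J, y, k) \<Rightarrow> y + k) \<and>
          (case t of (J, y, k) \<Rightarrow> y + k) < (case s of (J, y, k) \<Rightarrow> y + k)"
        by (simp add: eq)
    qed (use \<open>finite I\<close> I in auto)
    then show "(\<Sum>i\<in>{i \<in> I. f i = q}. ?w i) \<le> 1"
      by (simp add: case_prod_unfold)
  qed
  finally show ?thesis
    by simp
qed

lemma blocking_number_moment_curve_ge:
  fixes P :: "(real ^ 'n::{finite,linorder}) set"
  assumes P: "finite P" "P \<subseteq> range moment_curve" and n: "CARD('n) = 2 * r" and r: "r \<ge> 1"
    and large: "card P \<ge> max 64 (4 * r)"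
  shows "real (blocking_number P) \<ge>
    (1 / (8 * real (r - 1))) ^ (r - 1) / 16 * real (card P) ^ r * ln (real (card P))"
proof -
  obtain X where X: "finite X" "P = moment_curve ` X" "card X = card P"
    using finite_subset_image[OF P] card_moment_curve_image by metis
  let ?N = "card P"
  define m where "m = ?N div 4"
  \<comment> \<open>Having at least 64 points absorbs the rounding in \<open>m\<close>, and
    \<open>4 * r\<close> points give room for \<open>r - 1\<close> pairs.\<close>
  have m: "4 * m \<le> ?N" "real ?N / 8 \<le> real m" "r - 1 \<le> m"
    using large unfolding m_def by linarith+
  have "blocking_number P \<in> card ` {Q. finite Q \<and> blocks Q P}"
    unfolding blocking_number_def
  proof (rule Inf_nat_def1)
    have "\<exists>Q. finite Q \<and> blocks Q P"
      using P(1) n r by (intro finite_blocking_set_exists) auto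
    then show "card ` {Q. finite Q \<and> blocks Q P} \<noteq> {}"
      by blast
  qed
  then obtain Q where Q: "finite Q" "blocks Q P" "blocking_number P = card Q"
    by auto
  \<comment> \<open>This comes from \<open>m choose k\<close> being at least
    \<open>(m / k) ^ k\<close> with \<open>k = r - 1\<close> and from \<open>m\<close> being at
    least \<open>?N / 8\<close>. For \<open>r = 1\<close> it is \<open>0 ^ 0 = 1\<close>.\<close>
  let ?a = "(1 / (8 * real (r - 1))) ^ (r - 1)"
  have pos: "real ?N \<ge> 64" "ln (real ?N) \<ge> 0"
    using large by auto
  have "?a * real ?N ^ (r - 1) = (real ?N / 8 / real (r - 1)) ^ (r - 1)"
    by (simp add: power_divide power_mult_distrib)
  also have "\<dots> \<le> (real m / real (r - 1)) ^ (r - 1)"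
    using m by (intro power_mono divide_right_mono) auto
  also have "\<dots> \<le> real (m choose (r - 1))"
    using binomial_ge_n_over_k_pow_k[OF m(3)] .
  finally have binom: "?a * real ?N ^ (r - 1) \<le> real (m choose (r - 1))" .
  \<comment> \<open>This holds from 64 points on; passing to the square root only halves the
    logarithm.\<close>
  have "sqrt (real ?N) \<le> real ?N / 8"
    using pos by (intro real_le_lsqrt) (auto simp: power2_eq_square)
  then have "ln (sqrt (real ?N)) \<le> ln (real m + 1)"
    using m pos by (intro ln_mono) auto
  also have "\<dots> \<le> harm m"
    by (rule ln_le_harm)
  finally have harm: "ln (real ?N) / 2 \<le> harm m"
    using pos by (simp add: ln_sqrt)
  \<comment> \<open>The 16 combines the 8 from \<open>m\<close> with the 2 from the halved
    logarithm.\<close>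
  have "?a / 16 * real ?N ^ r * ln (real ?N) =
      (?a * real ?N ^ (r - 1)) * (real ?N / 8 * (ln (real ?N) / 2))"
    using r by (simp add: power_eq_if)
  also have "\<dots> \<le> real (m choose (r - 1)) * (real m * harm m)"
    using binom harm m pos by (intro mult_mono) auto
  also have "\<dots> \<le> real (card Q)"
  proof (rule card_blocking_set_ge[OF X(1) _ n r Q(1)])
    show "X \<noteq> {}"
      using X(3) large by auto
    show "blocks Q (moment_curve ` X)" "4 * m \<le> card X"
      using Q(2) X m(1) by simp_all
  qed
  finally show ?thesis
    using Q(3) by simp
qed

theorem corollary2:
  fixes r :: nat
  assumes "r \<ge> 1"
    and "CARD('n::{finite,linorder}) = 2 * r"
  shows "\<exists>c > 0. \<exists>N. \<forall>n \<ge> N. \<forall>P :: (real ^ 'n::{finite,linorder}) set.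
    finite P \<and> card P = n \<and> P \<subseteq> range moment_curve \<longrightarrow>
    real (blocking_number P) \<ge> c * real (max_triangulation_facets P) * ln (real n)"
proof -
  \<comment> \<open>\<open>a\<close> is the constant of the blocking bound and \<open>b\<close> that
    of the triangulation bound. Both bounds have order \<open>n ^ r\<close> up to the logarithm, so
    their quotient serves as the constant.\<close>
  define a where "a = (1 / (8 * real (r - 1))) ^ (r - 1) / 16"
  define b where "b = real (Suc (2 * r) * Suc r)"
  have a: "a > 0"
    using assms(1) by (cases "r = 1") (auto simp: a_def)
  have b: "b > 0"
    unfolding b_def of_nat_0_less_iff by simp
  show ?thesis
  \<comment> \<open>The threshold is that of the blocking bound; it also guarantees more than
    \<open>2 * r\<close> points, as the triangulation bound requires.\<close>
  proof (intro exI[of _ "a / b"] conjI exI[of _ "max 64 (4 * r)"] allI impI)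
    show "0 < a / b"
      using a b by (rule divide_pos_pos)
  next
    fix n and P :: "(real ^ 'n::{finite,linorder}) set"
    assume n: "max 64 (4 * r) \<le> n" and "finite P \<and> card P = n \<and> P \<subseteq> range moment_curve"
    then have P: "finite P" "P \<subseteq> range moment_curve" "card P = n"
      by auto
    have "max_triangulation_facets P \<le> Suc (2 * r) * (Suc r * card P ^ r)"
      using P n assms by (intro max_triangulation_facets_moment_curve_le) auto
    then have "real (max_triangulation_facets P) \<le> real (Suc (2 * r) * (Suc r * n ^ r))"
      unfolding P(3) by (rule of_nat_mono)
    also have "\<dots> = b * real n ^ r"
      by (simp only: b_def of_nat_mult of_nat_power mult.assoc)
    finally have "a / b * real (max_triangulation_facets P) * ln (real n) \<le>
        a / b * (b * real n ^ r) * ln (real n)"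
      using a b n by (intro mult_right_mono mult_left_mono) auto
    also have "\<dots> = a * real n ^ r * ln (real n)"
      using b by simp
    also have "\<dots> \<le> real (blocking_number P)"
      using blocking_number_moment_curve_ge[OF P(1,2) assms(2,1)] n unfolding P(3) a_def by simp
    finally show "a / b * real (max_triangulation_facets P) * ln (real n) \<le> real (blocking_number P)" .
  qed
qed

end
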